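(* Let $G$ be a connected graph of order $n\ge2$ whose distance Seidel eigenvalues are $\partial_1^S,\dots,\partial_n^S$. Then the distance Seidel eigenvalues of the double graph $D_2G$ are $2\partial_r^S-3$ for $r=1,\dots,n$ (each once), together with $3$ with multiplicity $n$.
   Context: For a connected graph $G$ with distance matrix $\mathcal{D}(G)$, the distance Seidel matrix is $\mathcal{D}^S(G)=J-I-2\mathcal{D}(G)$, $J$ the all-ones matrix; its eigenvalues are the distance Seidel eigenvalues. The double graph $D_2G$ of $G$ with $V(G)=\{v_1,\dots,v_n\}$ is obtained by taking a second copy with vertices $v_1',\dots,v_n'$ ($v_r'$ corresponding to $v_r$) and adding edges so that $D_2G$ has vertex set $\{v_r\}\cup\{v_r'\}$, contains $G$, and each $v_r'$ is adjacent to exactly the vertices $v_t$ and $v_t'$ with $v_t$ in the neighbourhood of $v_r$ in $G$ (equivalently $D_2G$ is $G$ with every vertex duplicated into two non-adjacent twins). *)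

theory Defs
  imports
    "Graph_Theory.Pair_Digraph"
    "Graph_Theory.Digraph_Component"
    "Graph_Theory.Shortest_Path"
    "Jordan_Normal_Form.Char_Poly"
    "HOL-Computational_Algebra.Polynomial"
    "HOL-Combinatorics.Multiset_Permutations"
begin

text \<open>
  A finite simple graph is a \<^locale>\<open>pair_graph\<close>: a finite, loop-free digraph whose arc relation
  \<^const>\<open>parcs\<close> is symmetric, each edge being the two arcs between its end points.
\<close>

text \<open>
  With every arc of weight 1, the least cost of a walk is the number of edges of a shortest path.
  In a connected graph it is finite, so that \<^const>\<open>real_of_ereal\<close> loses nothing.
\<close>

definition graph_dist :: "'a pair_pre_digraph \<Rightarrow> 'a \<Rightarrow> 'a \<Rightarrow> real" where
  "graph_dist G u v = real_of_ereal (wf_digraph.\<mu> (with_proj G) (\<lambda>_. 1) u v)"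

text \<open>
  Matrices are written with respect to an enumeration \<open>vs\<close> of the vertices
  (an element of \<^term>\<open>permutations_of_set (pverts G)\<close>); row and column \<open>i\<close> belong to \<open>vs ! i\<close>.
\<close>

definition distance_matrix :: "'a pair_pre_digraph \<Rightarrow> 'a list \<Rightarrow> real mat" where
  "distance_matrix G vs =
     mat (length vs) (length vs) (\<lambda>(i, j). graph_dist G (vs ! i) (vs ! j))"

definition distance_seidel_matrix :: "'a pair_pre_digraph \<Rightarrow> 'a list \<Rightarrow> real mat" where
  "distance_seidel_matrix G vs =
     mat (length vs) (length vs) (\<lambda>_. 1) - 1\<^sub>m (length vs) - 2 \<cdot>\<^sub>m distance_matrix G vs"

text \<open>
  The eigenvalues with their algebraic multiplicities. The matrix being real symmetric, all
  complex roots of its characteristic polynomial are real.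
\<close>

definition distance_seidel_eigenvalues :: "'a pair_pre_digraph \<Rightarrow> 'a list \<Rightarrow> real multiset" where
  "distance_seidel_eigenvalues G vs = proots (char_poly (distance_seidel_matrix G vs))"

text \<open>
  \<^term>\<open>(v, False)\<close> is the original vertex \<open>v\<close> and \<^term>\<open>(v, True)\<close> its copy \<open>v'\<close>.
\<close>

definition double_graph :: "'a pair_pre_digraph \<Rightarrow> ('a \<times> bool) pair_pre_digraph" where
  "double_graph G =
     \<lparr> pverts = pverts G \<times> UNIV,
       parcs = {((u, a), (v, b)) | u a v b. (u, v) \<in> parcs G} \<rparr>"

end

theory Submission
  imports Defs
begin

text \<open>
  Twins of \<open>D\<^sub>2G\<close> are at distance 2 and all other distances are those of \<open>G\<close>, so for the enumeration
  listing first the original vertices and then their copies the distance Seidel matrix of \<open>D\<^sub>2G\<close>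
  is the block matrix with diagonal blocks \<open>S\<close> and off-diagonal blocks \<open>T = S - 3I\<close>, where \<open>S\<close> is the
  one of \<open>G\<close>. All blocks commute, whence its characteristic polynomial at \<open>k\<close> is
  \<open>det ((kI - S)\<^sup>2 - (3I - S)\<^sup>2) = (k - 3)\<^sup>n 2\<^sup>n det ((k + 3)/2 I - S)\<close>.
\<close>

section \<open>Similarity of matrices under reordering of the index set\<close>

lemma sum_nth_Kronecker:
  fixes g :: "'b \<Rightarrow> 'a :: semiring_1"
  assumes "distinct xs" "x \<in> set xs"
  shows "(\<Sum>j = 0..<length xs. (if x = xs ! j then 1 else 0) * g (xs ! j)) = g x"
proof -
  have "(\<Sum>j\<in>{0..<length xs}. (if x = xs ! j then 1 else 0) * g (xs ! j)) =
      (\<Sum>y\<in>set xs. (if x = y then 1 else 0) * g y)"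
    by (intro sum.reindex_bij_betw[where g = "\<lambda>y. (if x = y then 1 else 0) * g y"] bij_betw_nth)
       (use assms in auto)
  also have "\<dots> = (\<Sum>y\<in>set xs. if x = y then g y else 0)"
    by (intro sum.cong) auto
  also have "\<dots> = g x" using assms by simp
  finally show ?thesis .
qed

text \<open>The conjugating matrix is the permutation matrix that matches equal entries of the two
  lists. Hence the spectrum does not depend on the enumeration, and a convenient one may be chosen
  for the double graph.\<close>

lemma similar_mat_reenumerate:
  fixes f :: "'b \<Rightarrow> 'b \<Rightarrow> 'a :: comm_ring_1"
  assumes xs: "distinct xs" and ys: "distinct ys" and eq: "set xs = set ys"
  shows "similar_mat (mat (length xs) (length xs) (\<lambda>(i, j). f (xs ! i) (xs ! j)))
                     (mat (length ys) (length ys) (\<lambda>(i, j). f (ys ! i) (ys ! j)))"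
proof -
  define n where "n = length xs"
  have n: "length xs = n" "length ys = n"
    using xs ys eq by (auto simp: n_def simp flip: distinct_card)
  define M where "M zs = mat n n (\<lambda>(i, j). f (zs ! i) (zs ! j))" for zs
  define P where "P as bs = (mat n n (\<lambda>(i, j). if as ! i = bs ! j then 1 else 0) :: 'a mat)" for as bs :: "'b list"
  have PP: "P as bs * P bs as = 1\<^sub>m n"
    if "distinct as" "distinct bs" "set as = set bs" "length as = n" "length bs = n" for as bs
  proof (rule eq_matI)
    fix i j assume "i < dim_row (1\<^sub>m n :: 'a mat)" "j < dim_col (1\<^sub>m n :: 'a mat)"
    then have ij: "i < n" "j < n" by auto
    have "(P as bs * P bs as) $$ (i, j) =
      (\<Sum>k = 0..<length bs. (if as ! i = bs ! k then 1 else 0) * (if bs ! k = as ! j then 1 else 0))"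
      using ij that by (simp add: P_def scalar_prod_def)
    also have "\<dots> = (if as ! i = as ! j then 1 else 0)"
      by (rule sum_nth_Kronecker) (use that ij nth_mem[of i as] in auto)
    finally show "(P as bs * P bs as) $$ (i, j) = 1\<^sub>m n $$ (i, j)"
      using ij that by (simp add: nth_eq_iff_index_eq)
  qed (auto simp: P_def)
  \<comment> \<open>Multiplication by a permutation matrix collapses each sum to one term: the entry
    at \<open>(i, j)\<close> is \<open>f (xs ! i) (ys ! j)\<close> on both sides.\<close>
  have "P xs ys * M ys = M xs * P xs ys"
  proof (rule eq_matI)
    fix i j assume "i < dim_row (M xs * P xs ys)" "j < dim_col (M xs * P xs ys)"
    then have ij: "i < n" "j < n" by (auto simp: M_def P_def)
    have "(P xs ys * M ys) $$ (i, j) =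
      (\<Sum>k = 0..<length ys. (if xs ! i = ys ! k then 1 else 0) * f (ys ! k) (ys ! j))"
      using ij n by (simp add: P_def M_def scalar_prod_def)
    also have "\<dots> = f (xs ! i) (ys ! j)"
      by (rule sum_nth_Kronecker) (use ij n eq ys nth_mem[of i xs] in auto)
    also have "\<dots> = (\<Sum>k = 0..<length xs. (if ys ! j = xs ! k then 1 else 0) * f (xs ! i) (xs ! k))"
      by (rule sum_nth_Kronecker[symmetric]) (use ij n eq xs nth_mem[of j ys] in auto)
    also have "\<dots> = (M xs * P xs ys) $$ (i, j)"
      using ij n by (simp add: P_def M_def scalar_prod_def mult.commute eq_commute[of "ys ! j"])
    finally show "(P xs ys * M ys) $$ (i, j) = (M xs * P xs ys) $$ (i, j)" .
  qed (auto simp: P_def M_def)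
  then have "P xs ys * M ys * P ys xs = M xs * (P xs ys * P ys xs)"
    by (simp add: P_def M_def assoc_mult_mat[of _ n n _ n _ n])
  also have "\<dots> = M xs"
    using PP[of xs ys] xs ys eq n by (simp add: M_def)
  finally have "M xs = P xs ys * M ys * P ys xs" ..
  moreover have "P xs ys * P ys xs = 1\<^sub>m n" "P ys xs * P xs ys = 1\<^sub>m n"
    using PP xs ys eq n by auto
  ultimately have "similar_mat (M xs) (M ys)"
    by (intro similar_matI[of _ _ "P xs ys" "P ys xs" n]) (auto simp: M_def P_def)
  then show ?thesis by (simp add: M_def n)
qed

section \<open>Roots under an affine substitution\<close>

text \<open>The substitution is invertible, so roots are transported by its inverse. Splitting off
  one linear factor at a time keeps track of multiplicities, even if \<open>p\<close> does not split
  over the field.\<close>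

lemma proots_pcompose_linear:
  fixes p :: "'a :: field poly"
  assumes b: "b \<noteq> 0"
  shows "proots (p \<circ>\<^sub>p [:a, b:]) = image_mset (\<lambda>x. (x - a) / b) (proots p)"
proof (induction "degree p" arbitrary: p rule: less_induct)
  case less
  show ?case
  \<comment> \<open>Here both multisets are empty; for \<open>p = 0\<close> this is the convention
    for \<open>proots\<close>.\<close>
  proof (cases "p = 0 \<or> (\<forall>x. poly p x \<noteq> 0)")
    case True
    have "proots q = {#}" if "\<forall>x. poly q x \<noteq> 0" for q :: "'a poly"
      using that by (cases "q = 0") (auto simp flip: set_mset_eq_empty_iff)
    with True show ?thesis by (auto simp: poly_pcompose)
  next
    case False
    then obtain c q where p: "p = [:- c, 1:] * q" and "p \<noteq> 0"
      by (auto simp: poly_eq_0_iff_dvd dvd_def)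
    then have q: "q \<noteq> 0" by auto
    have "degree p = Suc (degree q)"
      unfolding p using q by (subst degree_mult_eq) auto
    then have IH: "proots (q \<circ>\<^sub>p [:a, b:]) = image_mset (\<lambda>x. (x - a) / b) (proots q)"
      by (intro less) simp
    have lin: "[:- c, 1:] \<circ>\<^sub>p [:a, b:] = Polynomial.smult b [:(a - c) / b, 1:]"
      using b by (simp add: pcompose_pCons)
    have "q \<circ>\<^sub>p [:a, b:] \<noteq> 0"
      using q b by (simp add: pcompose_eq_0_iff)
    then have "proots (p \<circ>\<^sub>p [:a, b:]) =
        proots (Polynomial.smult b [:(a - c) / b, 1:]) + proots (q \<circ>\<^sub>p [:a, b:])"
      unfolding p pcompose_mult lin using b by (subst proots_mult) auto
    also have "\<dots> = {#(c - a) / b#} + image_mset (\<lambda>x. (x - a) / b) (proots q)"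
      unfolding IH proots_smult[OF b] by (simp add: minus_divide_left)
    also have "\<dots> = image_mset (\<lambda>x. (x - a) / b) (proots p)"
      unfolding p using q by (subst proots_mult) auto
    finally show ?thesis .
  qed
qed

section \<open>The characteristic polynomial of the block matrix\<close>

text \<open>The right-hand side is symmetric in \<open>a\<close> and \<open>b\<close>, which makes
  it visible that the two factors commute; it also serves to simplify a difference of two
  squares.\<close>

lemma mult_scalar_minus_mat:
  fixes S :: "'a :: comm_ring_1 mat"
  assumes S: "S \<in> carrier_mat n n"
  shows "(a \<cdot>\<^sub>m 1\<^sub>m n - S) * (b \<cdot>\<^sub>m 1\<^sub>m n - S) = (a * b) \<cdot>\<^sub>m 1\<^sub>m n - (a + b) \<cdot>\<^sub>m S + S * S"
proof -
  have "(a \<cdot>\<^sub>m 1\<^sub>m n - S) * (b \<cdot>\<^sub>m 1\<^sub>m n - S) =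
      a \<cdot>\<^sub>m 1\<^sub>m n * (b \<cdot>\<^sub>m 1\<^sub>m n) - a \<cdot>\<^sub>m 1\<^sub>m n * S - (S * (b \<cdot>\<^sub>m 1\<^sub>m n) - S * S)"
    using S mult_minus_distrib_mat[of _ n n "b \<cdot>\<^sub>m 1\<^sub>m n" n S]
    by (subst minus_mult_distrib_mat[of _ n n _ _ n]) (simp_all add: minus_carrier_mat)
  also have "\<dots> = (a * b) \<cdot>\<^sub>m 1\<^sub>m n - a \<cdot>\<^sub>m S - (b \<cdot>\<^sub>m S - S * S)"
    using S by (simp add: mult_smult_assoc_mat[of _ n n _ n] mult_smult_distrib[of _ n n _ n])
      (intro eq_matI, auto)
  also have "\<dots> = (a * b) \<cdot>\<^sub>m 1\<^sub>m n - (a + b) \<cdot>\<^sub>m S + S * S"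
    using S by (intro eq_matI) (auto simp: algebra_simps)
  finally show ?thesis .
qed

text \<open>The inner polynomial is the map taking \<open>k\<close> to \<open>(k + 3) / 2\<close>.
  Polynomials over the reals agree once their values do, so the identity is checked at each
  \<open>k\<close>.\<close>

lemma char_poly_twin_block:
  fixes S :: "real mat"
  assumes S: "S \<in> carrier_mat n n"
  defines "T \<equiv> S - 3 \<cdot>\<^sub>m 1\<^sub>m n"
  shows "char_poly (four_block_mat S T T S) =
    Polynomial.smult (2 ^ n) (char_poly S \<circ>\<^sub>p [:3 / 2, 1 / 2:]) * [:- 3, 1:] ^ n"
proof (rule poly_ext)
  fix k
  define A where "A = k \<cdot>\<^sub>m 1\<^sub>m n - S"
  define B where "B = 3 \<cdot>\<^sub>m 1\<^sub>m n - S"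
  have AB: "A \<in> carrier_mat n n" "B \<in> carrier_mat n n"
    using S by (auto simp: A_def B_def)
  have "poly (char_poly (four_block_mat S T T S)) k = det (four_block_mat A B B A)"
    using S by (subst char_poly_matrix[of _ "n + n"])
      (auto simp: T_def A_def B_def char_matrix_def intro!: arg_cong[where f = det] eq_matI)
  \<comment> \<open>The determinant formula for blocks requires the two lower blocks
    \<open>B\<close> and \<open>A\<close> to commute.\<close>
  also have "\<dots> = det (A * A - B * B)"
    by (rule det_four_block_mat)
       (use AB in \<open>auto simp: A_def B_def mult_scalar_minus_mat[OF S] mult.commute add.commute\<close>)
  also have "A * A - B * B = (2 * (k - 3)) \<cdot>\<^sub>m (((3 + k) / 2) \<cdot>\<^sub>m 1\<^sub>m n - S)"
    unfolding A_def B_def mult_scalar_minus_mat[OF S]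
    using S by (intro eq_matI) (auto simp: field_simps)
  also have "det \<dots> = (2 * (k - 3)) ^ n * det (((3 + k) / 2) \<cdot>\<^sub>m 1\<^sub>m n - S)"
    using S by simp
  also have "(2 * (k - 3)) ^ n = 2 ^ n * (k - 3) ^ n"
    by (rule power_mult_distrib)
  also have "det (((3 + k) / 2) \<cdot>\<^sub>m 1\<^sub>m n - S) = poly (char_poly S) ((3 + k) / 2)"
    using S by (subst char_poly_matrix[OF S])
      (auto simp: char_matrix_def intro!: arg_cong[where f = det] eq_matI)
  finally show "poly (char_poly (four_block_mat S T T S)) k =
      poly (Polynomial.smult (2 ^ n) (char_poly S \<circ>\<^sub>p [:3 / 2, 1 / 2:]) * [:- 3, 1:] ^ n) k"
    by (simp add: poly_pcompose add_divide_distrib)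
qed

section \<open>Distances in the double graph\<close>

lemma graph_dist_eq_INF_length:
  assumes "pair_wf_digraph G"
  shows "graph_dist G u v =
    real_of_ereal (INF p\<in>{p. pre_digraph.awalk (with_proj G) u p v}. ereal (length p))"
proof -
  interpret pair_wf_digraph G by fact
  have "awalk_cost (\<lambda>_. 1) p = length p" for p :: "('a \<times> 'a) list"
    by (induction p) auto
  then show ?thesis by (simp add: graph_dist_def \<mu>_def)
qed

lemma graph_dist_eqI:
  assumes "pair_wf_digraph G"
    and "pre_digraph.awalk (with_proj G) u p v"
    and "\<And>q. pre_digraph.awalk (with_proj G) u q v \<Longrightarrow> length p \<le> length q"
  shows "graph_dist G u v = length p"
proof -
  have "(INF p\<in>{p. pre_digraph.awalk (with_proj G) u p v}. ereal (length p)) = ereal (length p)"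
    by (rule INF_eqI) (use assms in auto)
  then show ?thesis using assms by (simp add: graph_dist_eq_INF_length)
qed

lemma parcs_double_graph_iff [simp]:
  "(x, y) \<in> parcs (double_graph G) \<longleftrightarrow> (fst x, fst y) \<in> parcs G"
  by (cases x; cases y) (auto simp: double_graph_def)

lemma pverts_double_graph [simp]: "pverts (double_graph G) = pverts G \<times> UNIV"
  by (simp add: double_graph_def)

context pair_wf_digraph
begin

lemma graph_dist_self: "u \<in> pverts G \<Longrightarrow> graph_dist G u u = 0"
  using graph_dist_eqI[of G u "[]" u] pair_wf_digraph_axioms by (simp add: awalk_Nil_iff)

lemma pair_wf_digraph_double_graph: "pair_wf_digraph (double_graph G)"
  by unfold_locales (auto simp: double_graph_def dest: in_arcsD1 in_arcsD2)

interpretation D: pair_wf_digraph "double_graph G"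
  by (rule pair_wf_digraph_double_graph)

lemma awalk_double_graph_project:
  "D.awalk x p y \<Longrightarrow> awalk (fst x) (map (map_prod fst fst) p) (fst y)"
  by (induction p arbitrary: x) (auto simp: awalk_Nil_iff D.awalk_Nil_iff awalk_Cons_iff D.awalk_Cons_iff)

text \<open>Every arc of \<open>G\<close> lifts to an arc between any prescribed copies of its ends,
  so the first arc can already pass to copy \<open>b\<close>, where the walk then stays. An empty
  walk could not change the copy.\<close>

lemma awalk_double_graph_lift:
  "awalk u p v \<Longrightarrow> p \<noteq> [] \<Longrightarrow> \<exists>q. D.awalk (u, a) q (v, b) \<and> length q = length p"
proof (induction p arbitrary: u a)
  case (Cons e p)
  then have e: "(u, snd e) \<in> parcs G" and p: "awalk (snd e) p v"
    by (auto simp: awalk_Cons_iff)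
  show ?case
  proof (cases "p = []")
    case True
    with e p show ?thesis
      by (intro exI[of _ "[((u, a), (v, b))]"])
         (auto simp: awalk_Nil_iff D.awalk_Cons_iff D.awalk_Nil_iff)
  next
    case False
    with Cons.IH[OF p] obtain q where "D.awalk (snd e, b) q (v, b)" "length q = length p"
      by blast
    with e show ?thesis
      by (intro exI[of _ "((u, a), (snd e, b)) # q"]) (auto simp: D.awalk_Cons_iff)
  qed
qed simp

text \<open>Projecting and lifting preserve length, so the two infima bound each other;
  \<open>u \<noteq> v\<close> excludes the empty walk, which may not lift.\<close>

lemma graph_dist_double_graph:
  assumes "u \<noteq> v"
  shows "graph_dist (double_graph G) (u, a) (v, b) = graph_dist G u v"
proof -
  have "(INF p\<in>{p. D.awalk (u, a) p (v, b)}. ereal (length p)) =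
      (INF p\<in>{p. awalk u p v}. ereal (length p))"
  proof (rule INF_eq)
    fix p assume "p \<in> {p. D.awalk (u, a) p (v, b)}"
    then show "\<exists>q\<in>{p. awalk u p v}. ereal (length q) \<le> ereal (length p)"
      using awalk_double_graph_project[of "(u, a)" p "(v, b)"]
      by (intro bexI[of _ "map (map_prod fst fst) p"]) auto
  next
    fix p assume p: "p \<in> {p. awalk u p v}"
    with assms have "p \<noteq> []" by (auto simp: awalk_Nil_iff)
    with p awalk_double_graph_lift[of u p v a b]
    show "\<exists>q\<in>{p. D.awalk (u, a) p (v, b)}. ereal (length q) \<le> ereal (length p)"
      by auto
  qed
  then show ?thesis
    by (simp add: graph_dist_eq_INF_length pair_wf_digraph_axioms pair_wf_digraph_double_graph)
qed

text \<open>A common neighbour gives a walk of length 2. Length 0 is impossible because the copies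
  differ, and length 1 would give a loop at \<open>u\<close> in \<open>G\<close>.\<close>

lemma graph_dist_double_graph_twin:
  assumes "(u, w) \<in> parcs G" "(w, u) \<in> parcs G" "(u, u) \<notin> parcs G" "a \<noteq> b"
  shows "graph_dist (double_graph G) (u, a) (u, b) = 2"
proof -
  let ?p = "[((u, a), (w, a)), ((w, a), (u, b))]"
  have "graph_dist (double_graph G) (u, a) (u, b) = length ?p"
  proof (rule graph_dist_eqI)
    show "D.awalk (u, a) ?p (u, b)"
      using assms in_arcsD1[OF assms(1)] by (simp add: D.awalk_Cons_iff D.awalk_Nil_iff)
  next
    fix q assume "D.awalk (u, a) q (u, b)"
    with assms show "length ?p \<le> length q"
      by (cases q; cases "tl q") (auto simp: D.awalk_Cons_iff D.awalk_Nil_iff)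
  qed (rule pair_wf_digraph_double_graph)
  then show ?thesis by simp
qed

end

text \<open>The neighbour is the end of the first arc on a walk from \<open>u\<close> to some other
  vertex.\<close>

lemma (in pair_graph) ex_neighbour:
  assumes "connected (with_proj G)" "2 \<le> card (pverts G)" "u \<in> pverts G"
  obtains w where "(u, w) \<in> parcs G" "(w, u) \<in> parcs G"
proof -
  have "pverts G \<noteq> {u}" using assms by auto
  then obtain v where v: "v \<in> pverts G" "v \<noteq> u" using assms by blast
  \<comment> \<open>Connectedness is defined through the symmetric closure, which has the same
    reachability since the arcs are already symmetric.\<close>
  have "u \<rightarrow>\<^sup>*\<^bsub>with_proj G\<^esub> v"
    using assms v reachable_mk_symmetric_eq[OF sym_arcs]
    by (auto simp: connected_def strongly_connected_def)
  then obtain p where p: "awalk u p v" by (auto simp: reachable_awalk)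
  with v obtain e q where "p = e # q" by (cases p) (auto simp: awalk_Nil_iff)
  with p have "(u, snd e) \<in> parcs G" by (auto simp: awalk_Cons_iff)
  moreover from this have "(snd e, u) \<in> parcs G"
    using arcs_ends_symmetric[OF pair_sym_arcs] by simp
  ultimately show ?thesis using that by blast
qed

section \<open>The distance Seidel matrix of the double graph\<close>

text \<open>Expresses entries through vertices instead of indices, as reordering requires;
  distinctness turns the identity matrix into equality of vertices.\<close>

lemma distance_seidel_matrix_eq:
  assumes "distinct vs"
  shows "distance_seidel_matrix G vs = mat (length vs) (length vs)
    (\<lambda>(i, j). (\<lambda>u v. 1 - of_bool (u = v) - 2 * graph_dist G u v) (vs ! i) (vs ! j))"
  using assms
  by (intro eq_matI)
     (auto simp: distance_seidel_matrix_def distance_matrix_def nth_eq_iff_index_eq)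

lemma distance_seidel_eigenvalues_reenumerate:
  assumes "distinct vs" "distinct ws" "set vs = set ws"
  shows "distance_seidel_eigenvalues G vs = distance_seidel_eigenvalues G ws"
  unfolding distance_seidel_eigenvalues_def distance_seidel_matrix_eq[OF assms(1)]
    distance_seidel_matrix_eq[OF assms(2)]
  by (subst char_poly_similar[OF similar_mat_reenumerate[OF assms]]) simp

lemma (in pair_graph) distance_seidel_matrix_double_graph:
  assumes "connected (with_proj G)" "2 \<le> card (pverts G)"
    and vs: "distinct vs" "set vs = pverts G"
  defines "S \<equiv> distance_seidel_matrix G vs"
  defines "T \<equiv> S - 3 \<cdot>\<^sub>m 1\<^sub>m (length vs)"
  shows "distance_seidel_matrix (double_graph G)
      (map (\<lambda>v. (v, False)) vs @ map (\<lambda>v. (v, True)) vs) = four_block_mat S T T S"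
proof -
  have twin: "graph_dist (double_graph G) (u, a) (u, b) = (if a = b then 0 else 2)"
    if u: "u \<in> pverts G" for u a b
  proof -
    obtain w where "(u, w) \<in> parcs G" "(w, u) \<in> parcs G"
      by (rule ex_neighbour[OF assms(1,2) u])
    with u show ?thesis
      using graph_dist_double_graph_twin[of u w a b] no_loops'[of u u]
        pair_wf_digraph.graph_dist_self[OF pair_wf_digraph_double_graph, of "(u, a)"]
      by auto
  qed
  define f where "f u v = 1 - of_bool (u = v) - 2 * graph_dist G u v" for u v
  define g where "g x y = 1 - of_bool (x = y) - 2 * graph_dist (double_graph G) x y" for x y
  \<comment> \<open>The 3 arises at twins: their entry is \<open>1 - 0 - 2 * 2 = -3\<close>, whereas
    \<open>f u u = 1 - 1 - 0 = 0\<close>.\<close>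
  have g: "g (u, a) (v, b) = (if a = b then f u v else f u v - (if u = v then 3 else 0))"
    if "u \<in> pverts G" for u v a b
    using twin[OF that] graph_dist_double_graph[of u v a b] graph_dist_self[OF that]
    by (auto simp: f_def g_def)
  define n where "n = length vs"
  let ?ws = "map (\<lambda>v. (v, False)) vs @ map (\<lambda>v. (v, True)) vs"
  have S: "S = mat n n (\<lambda>(i, j). f (vs ! i) (vs ! j))"
    using distance_seidel_matrix_eq[OF vs(1)] by (simp add: S_def n_def f_def)
  have ws: "?ws ! i = (vs ! (if i < n then i else i - n), n \<le> i)" if "i < n + n" for i
    using that by (auto simp: n_def nth_append)
  have "distinct ?ws"
    using vs by (auto simp: distinct_map inj_on_def)
  then have "distance_seidel_matrix (double_graph G) ?ws =
      mat (n + n) (n + n) (\<lambda>(i, j). g (?ws ! i) (?ws ! j))"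
    unfolding distance_seidel_matrix_eq[OF \<open>distinct ?ws\<close>] by (simp add: n_def g_def)
  also have "\<dots> = four_block_mat S T T S"
  proof (rule eq_matI)
    fix i j assume "i < dim_row (four_block_mat S T T S)" "j < dim_col (four_block_mat S T T S)"
    then have ij: "i < n + n" "j < n + n" by (auto simp: S)
    have in_V: "vs ! k \<in> pverts G" if "k < n" for k
      using that unfolding n_def vs(2)[symmetric] by (rule nth_mem)
    have inj: "vs ! k = vs ! l \<longleftrightarrow> k = l" if "k < n" "l < n" for k l
      using that nth_eq_iff_index_eq[OF vs(1), of k l] by (simp add: n_def)
    have "mat (n + n) (n + n) (\<lambda>(i, j). g (?ws ! i) (?ws ! j)) $$ (i, j) =
        g (vs ! (if i < n then i else i - n), n \<le> i) (vs ! (if j < n then j else j - n), n \<le> j)"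
      using ij by (simp only: index_mat split ws)
    also have "\<dots> = four_block_mat S T T S $$ (i, j)"
      using ij by (cases "i < n"; cases "j < n")
        (simp_all add: S T_def g in_V inj flip: n_def)
    finally show "mat (n + n) (n + n) (\<lambda>(i, j). g (?ws ! i) (?ws ! j)) $$ (i, j) =
        four_block_mat S T T S $$ (i, j)" .
  qed (simp_all add: S T_def)
  finally show ?thesis .
qed

theorem theorem6p3:
  fixes G :: "'a pair_pre_digraph" and n :: nat and \<theta> :: "nat \<Rightarrow> real"
    and vs :: "'a list" and ws :: "('a \<times> bool) list"
  assumes "pair_graph G" and "Digraph_Component.connected (with_proj G)"
    and "card (pverts G) = n" and "n \<ge> 2"
    and "vs \<in> permutations_of_set (pverts G)"
    and "ws \<in> permutations_of_set (pverts (double_graph G))"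
    and "distance_seidel_eigenvalues G vs = {# \<theta> r. r \<in># mset_set {1..n} #}"
  shows "distance_seidel_eigenvalues (double_graph G) ws =
           {# 2 * \<theta> r - 3. r \<in># mset_set {1..n} #} + replicate_mset n 3"
proof -
  interpret pair_graph G by fact
  have vs: "distinct vs" "set vs = pverts G" "length vs = n"
    using assms(3,5) distinct_card[of vs] by (auto simp: permutations_of_set_def)
  have ws: "distinct ws" "set ws = pverts G \<times> UNIV"
    using assms(6) by (auto simp: permutations_of_set_def)
  define S where "S = distance_seidel_matrix G vs"
  have S: "S \<in> carrier_mat n n"
    using vs by (intro carrier_matI) (simp_all add: S_def distance_seidel_matrix_def distance_matrix_def)
  define p where "p = char_poly S \<circ>\<^sub>p [:3 / 2, 1 / 2:]"
  \<comment> \<open>Nonzero factors are required for the roots of a product to be the sum of the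
    multisets of roots.\<close>
  have "char_poly S \<noteq> 0"
    using degree_monic_char_poly[OF S] by auto
  then have p: "p \<noteq> 0"
    by (simp add: p_def pcompose_eq_0_iff)
  have "distance_seidel_eigenvalues (double_graph G) ws =
      distance_seidel_eigenvalues (double_graph G) (map (\<lambda>v. (v, False)) vs @ map (\<lambda>v. (v, True)) vs)"
    using vs ws UNIV_bool
    by (intro distance_seidel_eigenvalues_reenumerate) (auto simp: distinct_map inj_on_def)
  also have "\<dots> = proots (Polynomial.smult (2 ^ n) p * [:- 3, 1:] ^ n)"
    unfolding distance_seidel_eigenvalues_def p_def
    using distance_seidel_matrix_double_graph[OF assms(2) _ vs(1,2)] assms(3,4) vs(3)
      char_poly_twin_block[OF S]
    by (simp add: S_def)
  also have "\<dots> = proots p + replicate_mset n 3"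
    using p by (subst proots_mult) (auto simp: proots_power)
  \<comment> \<open>The inverse of the substitution is
    \<open>(x - 3/2) / (1/2) = 2 * x - 3\<close>.\<close>
  also have "proots p = image_mset (\<lambda>x. 2 * x - 3) (proots (char_poly S))"
    unfolding p_def by (subst proots_pcompose_linear) (auto simp: field_simps intro!: image_mset_cong)
  also have "\<dots> = {# 2 * \<theta> r - 3. r \<in># mset_set {1..n} #}"
    using assms(7) by (simp add: distance_seidel_eigenvalues_def S_def multiset.map_comp o_def)
  finally show ?thesis .
qed

end
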